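(* For every $n\ge2$, the closed unit ball $\overline{B}^{\,n}\subseteq\mathbb{R}^n$ and the quartic body $S_n=\{x\in\mathbb{R}^n:\sum_{i=1}^n x_i^4\le1\}$ are not $\mathcal{L}_{\mathrm{B}}$-elementarily equivalent.
   Context: $\mathcal{L}_{\mathrm{B}}$ is the first-order language with a single ternary relation symbol $B$. A convex set $K\subseteq\mathbb{R}^n$ is an $\mathcal{L}_{\mathrm{B}}$-structure with universe $K$, where $B(a,x,b)$ holds iff $x\in[a,b]$ (the closed segment). Two structures are $\mathcal{L}_{\mathrm{B}}$-elementarily equivalent if they satisfy the same first-order $\mathcal{L}_{\mathrm{B}}$-sentences. *)

theory Defs
  imports "HOL-Analysis.Analysis"
begin

text \<open>First-order formulas with equality over a single ternary relation symbol.
  Variables are named by natural numbers; the remaining connectives and the universal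
  quantifier are the usual classical abbreviations.\<close>

datatype lb_formula =
    Eq nat nat
  | Btw nat nat nat
  | Neg lb_formula
  | Conj lb_formula lb_formula
  | Exists nat lb_formula

fun free_vars :: "lb_formula \<Rightarrow> nat set" where
  "free_vars (Eq i j) = {i, j}"
| "free_vars (Btw i j k) = {i, j, k}"
| "free_vars (Neg \<phi>) = free_vars \<phi>"
| "free_vars (Conj \<phi> \<psi>) = free_vars \<phi> \<union> free_vars \<psi>"
| "free_vars (Exists i \<phi>) = free_vars \<phi> - {i}"

definition sentence :: "lb_formula \<Rightarrow> bool" where
  "sentence \<phi> \<longleftrightarrow> free_vars \<phi> = {}"

text \<open>A structure is a universe together with an interpretation of the relation symbol, of
  which only the restriction to the universe matters.\<close>

type_synonym 'a lb_structure = "'a set \<times> ('a \<Rightarrow> 'a \<Rightarrow> 'a \<Rightarrow> bool)"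

fun sat :: "'a lb_structure \<Rightarrow> (nat \<Rightarrow> 'a) \<Rightarrow> lb_formula \<Rightarrow> bool" where
  "sat M s (Eq i j) \<longleftrightarrow> s i = s j"
| "sat M s (Btw i j k) \<longleftrightarrow> snd M (s i) (s j) (s k)"
| "sat M s (Neg \<phi>) \<longleftrightarrow> \<not> sat M s \<phi>"
| "sat M s (Conj \<phi> \<psi>) \<longleftrightarrow> sat M s \<phi> \<and> sat M s \<psi>"
| "sat M s (Exists i \<phi>) \<longleftrightarrow> (\<exists>a\<in>fst M. sat M (s(i := a)) \<phi>)"

lemma sat_cong_free_vars:
  "(\<And>i. i \<in> free_vars \<phi> \<Longrightarrow> s i = t i) \<Longrightarrow> sat M s \<phi> = sat M t \<phi>"
proof (induction \<phi> arbitrary: s t)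
  case (Eq i j)
  then show ?case by simp
next
  case (Btw i j k)
  then show ?case by simp
next
  case (Neg \<phi>)
  have "sat M s \<phi> = sat M t \<phi>"
    by (rule Neg.IH) (simp add: Neg.prems)
  then show ?case by simp
next
  case (Conj \<phi> \<psi>)
  have "sat M s \<phi> = sat M t \<phi>"
    by (rule Conj.IH(1)) (simp add: Conj.prems)
  moreover have "sat M s \<psi> = sat M t \<psi>"
    by (rule Conj.IH(2)) (simp add: Conj.prems)
  ultimately show ?case by simp
next
  case (Exists i \<phi>)
  have "sat M (s(i := a)) \<phi> = sat M (t(i := a)) \<phi>" for a
    by (rule Exists.IH) (simp add: Exists.prems)
  then show ?case by simp
qed

definition models :: "'a lb_structure \<Rightarrow> lb_formula \<Rightarrow> bool" where
  "models M \<phi> \<longleftrightarrow> (\<forall>s. sat M s \<phi>)"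

text \<open>For sentences the choice of assignment is irrelevant, so that the quantification over
  assignments in the definition above (which need not take values in the universe) is harmless.\<close>

lemma models_sentence:
  assumes "sentence \<phi>"
  shows "models M \<phi> \<longleftrightarrow> sat M s \<phi>"
proof -
  have "sat M t \<phi> = sat M s \<phi>" for t
    by (rule sat_cong_free_vars) (use assms in \<open>simp add: sentence_def\<close>)
  then show ?thesis unfolding models_def by blast
qed

definition elementarily_equivalent :: "'a lb_structure \<Rightarrow> 'b lb_structure \<Rightarrow> bool" where
  "elementarily_equivalent M N \<longleftrightarrow> (\<forall>\<phi>. sentence \<phi> \<longrightarrow> models M \<phi> = models N \<phi>)"

definition segment_structure :: "'a::real_vector set \<Rightarrow> 'a lb_structure" where
  "segment_structure K = (K, \<lambda>a x b. x \<in> closed_segment a b)"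

definition quartic_body :: "(real ^ 'n) set" where
  "quartic_body = {x. (\<Sum>i\<in>UNIV. (x $ i) ^ 4) \<le> 1}"

end

theory Submission
  imports Defs
begin

text \<open>Let \<open>p\<close> be a point inside the ball. Exchanging the two endpoints of every chord through \<open>p\<close>
  extends to a projective map of the ball, the harmonic homology with centre \<open>p\<close>. It maps
  segments to segments, and \<open>p\<close> lies between any point and its image. So if chords \<open>a a'\<close>, \<open>b b'\<close>,
  \<open>d d'\<close> pass through \<open>p\<close>, and \<open>a d'\<close> and \<open>b a'\<close> meet in \<open>m\<close>, then \<open>a' d\<close> and \<open>b' a\<close> meet in a
  point \<open>m'\<close> with \<open>p\<close> between \<open>m\<close> and \<open>m'\<close>. This can be said with betweenness alone, since endpoints
  of chords are extreme points. In a coordinate plane of the quartic body it fails for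
  \<open>a, a' = (\<plusminus>1, 0)\<close>, \<open>b = (c, c)\<close>, \<open>b' = (0, -1)\<close>, \<open>d = (c, -c)\<close>, \<open>d' = (0, 1)\<close> with \<open>2 c^4 = 1\<close>:
  the points \<open>m\<close>, \<open>p\<close>, \<open>m'\<close> would be collinear only if \<open>2 c^2 = 1\<close>.\<close>

section \<open>The distinguishing sentence\<close>

text \<open>The bound names 9 and 10 stay clear of the names 0 to 8 of the configuration, so no
  capture occurs.\<close>

definition extreme_formula :: "nat \<Rightarrow> lb_formula" where
  "extreme_formula i =
     Neg (Exists 9 (Exists 10 (Conj (Btw 9 i 10) (Conj (Neg (Eq i 9)) (Neg (Eq i 10))))))"

text \<open>The variables 0 to 8 stand for p, m, a, a', b, b', d, d', m' in this order. Keeping p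
  away from a and a' forces p into the open ball when the universe is the ball.\<close>

definition homology_counterexample :: lb_formula where
  "homology_counterexample =
     Exists 0 (Exists 1 (Exists 2 (Exists 3 (Exists 4 (Exists 5 (Exists 6 (Exists 7
      (Conj (Conj (extreme_formula 2) (Conj (extreme_formula 3) (Conj (extreme_formula 4)
              (Conj (extreme_formula 5) (Conj (extreme_formula 6) (extreme_formula 7))))))
      (Conj (Conj (Neg (Eq 0 2)) (Neg (Eq 0 3)))
      (Conj (Conj (Btw 2 0 3) (Conj (Btw 4 0 5) (Btw 6 0 7)))
      (Conj (Conj (Btw 2 1 7) (Btw 4 1 3))
        (Neg (Exists 8 (Conj (Btw 3 8 6) (Conj (Btw 5 8 2) (Btw 1 0 8))))))))))))))))"

lemma sentence_homology_counterexample: "sentence homology_counterexample"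
  by (auto simp: sentence_def homology_counterexample_def extreme_formula_def)

lemma sat_extreme_formula:
  assumes "i \<noteq> 9" "i \<noteq> 10" "s i \<in> K"
  shows "sat (segment_structure K) s (extreme_formula i) \<longleftrightarrow> s i extreme_point_of K"
  using assms
  by (auto simp: extreme_formula_def segment_structure_def extreme_point_of_def open_segment_def)

lemma models_homology_counterexample:
  "models (segment_structure K) homology_counterexample \<longleftrightarrow>
    (\<exists>p\<in>K. \<exists>m\<in>K. \<exists>a\<in>K. \<exists>a'\<in>K. \<exists>b\<in>K. \<exists>b'\<in>K. \<exists>d\<in>K. \<exists>d'\<in>K.
      (a extreme_point_of K \<and> a' extreme_point_of K \<and> b extreme_point_of K \<and>
      b' extreme_point_of K \<and> d extreme_point_of K \<and> d' extreme_point_of K) \<and>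
      (p \<noteq> a \<and> p \<noteq> a') \<and>
      (p \<in> closed_segment a a' \<and> p \<in> closed_segment b b' \<and> p \<in> closed_segment d d') \<and>
      (m \<in> closed_segment a d' \<and> m \<in> closed_segment b a') \<and>
      \<not> (\<exists>m'\<in>K. m' \<in> closed_segment a' d \<and> m' \<in> closed_segment b' a \<and> p \<in> closed_segment m m'))"
proof -
  have univ: "fst (segment_structure K) = K"
    and rel: "snd (segment_structure K) = (\<lambda>a x b. x \<in> closed_segment a b)"
    by (simp_all add: segment_structure_def)
  show ?thesis
    \<comment> \<open>Any assignment serves here, since the formula has no free variables.\<close>
    unfolding models_sentence[OF sentence_homology_counterexample, of _ undefined]
    \<comment> \<open>The congruence rules provide the membership in \<open>K\<close> that
      \<open>sat_extreme_formula\<close> requires.\<close>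
    by (simp add: homology_counterexample_def sat_extreme_formula univ rel cong: bex_cong conj_cong)
qed

section \<open>The harmonic homology of the ball\<close>

text \<open>For p \<noteq> 0 the axis is the polar hyperplane \<open>p \<bullet> x = 1\<close> of p
  with respect to the unit sphere; for p = 0 the map is x \<mapsto> -x.\<close>

definition homology :: "'a::real_inner \<Rightarrow> 'a \<Rightarrow> 'a" where
  "homology p x = p + ((1 - p \<bullet> p) / (1 + p \<bullet> p - 2 * (p \<bullet> x))) *\<^sub>R (p - x)"

text \<open>By Cauchy-Schwarz the denominator is at least \<open>(1 - norm p)\<^sup>2\<close>. Hence
  the hyperplane sent to infinity misses the ball.\<close>

lemma homology_denominator_pos:
  assumes "norm p < 1" "norm x \<le> 1"
  shows "1 + p \<bullet> p - 2 * (p \<bullet> x) > 0"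
proof -
  have "p \<bullet> x \<le> norm p * norm x" by (rule norm_cauchy_schwarz)
  also have "\<dots> \<le> norm p" using assms(2) by (simp add: mult_left_le)
  finally have "p \<bullet> x \<le> norm p" .
  moreover have "0 < (1 - norm p)\<^sup>2" using assms(1) by simp
  ultimately show ?thesis by (simp add: power2_diff dot_square_norm)
qed

text \<open>Write p = x + u w with w = x' - x. Both endpoints being unit vectors gives
  \<open>2 * (x \<bullet> w) = - (w \<bullet> w)\<close>, which reduces the scaling factor to (1 -
  u) / u. This turns p - x = u w into (1 - u) w = x' - p.\<close>

lemma homology_swaps_chord_endpoints:
  assumes p: "norm p < 1" and x: "norm x = 1" "norm x' = 1" and seg: "p \<in> closed_segment x x'"
  shows "homology p x = x'"
proof -
  obtain u where u: "p = (1 - u) *\<^sub>R x + u *\<^sub>R x'"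
    using seg by (auto simp: in_segment)
  define w where "w = x' - x"
  have pw: "p = x + u *\<^sub>R w" and x': "x' = x + w"
    by (simp_all add: u w_def algebra_simps)
  have xx: "x \<bullet> x = 1" using x by (simp add: dot_square_norm)
  have "x' \<bullet> x' = 1" using x by (simp add: dot_square_norm)
  hence ww: "2 * (x \<bullet> w) = - (w \<bullet> w)"
    by (simp add: x' xx inner_simps inner_commute)
  have num: "1 - p \<bullet> p = (u - u\<^sup>2) * (w \<bullet> w)"
    using arg_cong[OF ww, of "\<lambda>t. u * t"]
    by (simp add: pw xx inner_simps inner_commute power2_eq_square algebra_simps)
  have den: "1 + p \<bullet> p - 2 * (p \<bullet> x) = u\<^sup>2 * (w \<bullet> w)"
    by (simp add: pw xx inner_simps inner_commute power2_eq_square algebra_simps)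
  have "u\<^sup>2 * (w \<bullet> w) > 0"
    using homology_denominator_pos[OF p, of x] x unfolding den by simp
  hence "u \<noteq> 0" "w \<bullet> w \<noteq> 0" by auto
  hence "(1 - p \<bullet> p) / (1 + p \<bullet> p - 2 * (p \<bullet> x)) * u = 1 - u"
    unfolding num den by (simp add: field_simps power2_eq_square)
  hence "homology p x = p + (1 - u) *\<^sub>R w"
    by (simp add: homology_def pw)
  thus ?thesis by (simp add: pw x' algebra_simps)
qed

text \<open>The denominator \<open>D\<close> is affine in the point and positive on the ball. A
  convex combination is therefore sent to one whose weights are the old ones multiplied by
  \<open>D x\<close> and \<open>D y\<close> and renormalised by \<open>D m\<close>.\<close>

lemma homology_closed_segment:
  assumes p: "norm p < 1" and xy: "norm x \<le> 1" "norm y \<le> 1" and m: "m \<in> closed_segment x y"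
  shows "homology p m \<in> closed_segment (homology p x) (homology p y)"
proof -
  define D where "D z = 1 + p \<bullet> p - 2 * (p \<bullet> z)" for z
  obtain u where u: "0 \<le> u" "u \<le> 1" "m = (1 - u) *\<^sub>R x + u *\<^sub>R y"
    using m by (auto simp: in_segment)
  have Dx: "D x > 0" and Dy: "D y > 0"
    using homology_denominator_pos[OF p] xy by (auto simp: D_def)
  have Dm: "D m = (1 - u) * D x + u * D y"
    by (simp add: D_def u inner_simps algebra_simps)
  have "D m > 0"
    unfolding Dm using Dx Dy u(1,2) by (cases "u = 0") (auto intro: add_nonneg_pos)
  define v where "v = u * D y / D m"
  have "1 - v = (D m - u * D y) / D m"
    using \<open>D m > 0\<close> by (simp add: v_def diff_divide_distrib)
  hence v1: "1 - v = (1 - u) * D x / D m" by (simp add: Dm)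
  have "0 \<le> 1 - v" unfolding v1 using \<open>D m > 0\<close> Dx u(2) by simp
  moreover have "0 \<le> v" unfolding v_def using \<open>D m > 0\<close> Dy u(1) by simp
  ultimately have v: "0 \<le> v" "v \<le> 1" by simp_all
  have hom: "homology p z = p + ((1 - p \<bullet> p) / D z) *\<^sub>R (p - z)" for z
    by (simp add: homology_def D_def)
  have "(1 - v) *\<^sub>R homology p x + v *\<^sub>R homology p y =
      p + ((1 - v) * ((1 - p \<bullet> p) / D x)) *\<^sub>R (p - x) + (v * ((1 - p \<bullet> p) / D y)) *\<^sub>R (p - y)"
    unfolding hom by (simp add: scaleR_add_right scaleR_left_diff_distrib)
  also have "(1 - v) * ((1 - p \<bullet> p) / D x) = (1 - p \<bullet> p) / D m * (1 - u)"
    using Dx by (simp add: v1)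
  also have "v * ((1 - p \<bullet> p) / D y) = (1 - p \<bullet> p) / D m * u"
    using Dy by (simp add: v_def)
  also have "p + ((1 - p \<bullet> p) / D m * (1 - u)) *\<^sub>R (p - x) + ((1 - p \<bullet> p) / D m * u) *\<^sub>R (p - y) =
      p + ((1 - p \<bullet> p) / D m) *\<^sub>R ((1 - u) *\<^sub>R (p - x) + u *\<^sub>R (p - y))"
    by (simp add: scaleR_add_right)
  also have "(1 - u) *\<^sub>R (p - x) + u *\<^sub>R (p - y) = p - m"
    by (simp add: u algebra_simps)
  finally have "homology p m = (1 - v) *\<^sub>R homology p x + v *\<^sub>R homology p y"
    by (simp add: hom)
  thus ?thesis using v by (auto simp: in_segment)
qed

text \<open>The scaling factor k is positive, so p divides the segment from x to its image with
  weights k / (1 + k) and 1 / (1 + k).\<close>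

lemma center_between_homology:
  assumes p: "norm p < 1" and x: "norm x \<le> 1"
  shows "p \<in> closed_segment x (homology p x)"
proof -
  define k where "k = (1 - p \<bullet> p) / (1 + p \<bullet> p - 2 * (p \<bullet> x))"
  have "p \<bullet> p < 1" using p by (simp add: dot_square_norm power_less_one_iff)
  hence k: "k > 0"
    unfolding k_def using homology_denominator_pos[OF p x] by simp
  have "p = (1 - 1 / (1 + k)) *\<^sub>R x + (1 / (1 + k)) *\<^sub>R (p + k *\<^sub>R (p - x))"
  proof -
    have "(1 - 1 / (1 + k)) *\<^sub>R x + (1 / (1 + k)) *\<^sub>R (p + k *\<^sub>R (p - x)) =
        (1 / (1 + k)) *\<^sub>R (k *\<^sub>R x + (p + k *\<^sub>R (p - x)))"
      using k by (simp add: scaleR_add_right divide_simps)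
    also have "\<dots> = (1 / (1 + k)) *\<^sub>R ((1 + k) *\<^sub>R p)"
      by (simp add: algebra_simps)
    also have "\<dots> = p" using k by simp
    finally show ?thesis by simp
  qed
  thus ?thesis using k unfolding in_segment homology_def k_def[symmetric]
    by (intro exI[of _ "1 / (1 + k)"]) auto
qed

lemma extreme_point_of_cball_norm:
  fixes x :: "'a::euclidean_space"
  assumes "x extreme_point_of cball 0 1"
  shows "norm x = 1"
  using extreme_point_not_in_interior[OF assms] assms
  by (auto simp: extreme_point_of_def)

lemma cball_no_homology_counterexample:
  "\<not> models (segment_structure (cball 0 1 :: 'a::euclidean_space set)) homology_counterexample"
proof
  assume "models (segment_structure (cball 0 1 :: 'a set)) homology_counterexample"
  then obtain p m a a' b b' d d' :: 'a where
    ext: "a extreme_point_of cball 0 1" "a' extreme_point_of cball 0 1"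
      "b extreme_point_of cball 0 1" "b' extreme_point_of cball 0 1"
      "d extreme_point_of cball 0 1" "d' extreme_point_of cball 0 1"
    and pa: "p \<noteq> a" "p \<noteq> a'" "p \<in> closed_segment a a'"
    and p: "p \<in> closed_segment b b'" "p \<in> closed_segment d d'"
    and m: "m \<in> closed_segment a d'" "m \<in> closed_segment b a'" "m \<in> cball 0 1"
    and none: "\<And>m'. m' \<in> cball 0 1 \<Longrightarrow> m' \<in> closed_segment a' d \<Longrightarrow> m' \<in> closed_segment b' a \<Longrightarrow>
      p \<notin> closed_segment m m'"
    unfolding models_homology_counterexample by blast
  \<comment> \<open>A point strictly inside a chord of the sphere is closer to the centre than the
    endpoints.\<close>
  have p_open: "p \<in> open_segment a a'"
    using pa by (simp add: open_segment_def)
  note norms = ext[THEN extreme_point_of_cball_norm]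
  have np: "norm p < 1"
    using dist_decreases_open_segment[OF p_open, of 0] norms by auto
  have swap: "homology p a = a'" "homology p a' = a" "homology p b = b'" "homology p d' = d"
    using norms p pa
    by (auto intro!: homology_swaps_chord_endpoints[OF np] simp: closed_segment_commute)
  \<comment> \<open>The forbidden point m' is the image of m: the homology carries [a, d'] to
    [a', d] and [b, a'] to [b', a].\<close>
  have "homology p m \<in> closed_segment a' d"
    using homology_closed_segment[OF np _ _ m(1)] norms swap by simp
  moreover have "homology p m \<in> closed_segment b' a"
    using homology_closed_segment[OF np _ _ m(2)] norms swap by simp
  moreover have "closed_segment a' d \<subseteq> cball 0 1"
    using norms by (intro closed_segment_subset) auto
  moreover have "p \<in> closed_segment m (homology p m)"
    using center_between_homology[OF np] m(3) by simp
  ultimately show False using none by blast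
qed

section \<open>Extreme points of the quartic body\<close>

lemma fourth_power_strictly_convex:
  fixes x y u :: real
  assumes "x \<noteq> y" "0 < u" "u < 1"
  shows "((1 - u) * x + u * y) ^ 4 < (1 - u) * x ^ 4 + u * y ^ 4"
proof -
  \<comment> \<open>The last term is the convexity defect of squaring. The identity is used twice:
    strictly for x and y, then weakly for their squares.\<close>
  have square: "((1 - u) * s + u * t)\<^sup>2 = (1 - u) * s\<^sup>2 + u * t\<^sup>2 - u * (1 - u) * (s - t)\<^sup>2"
    for s t :: real by algebra
  have u: "u * (1 - u) > 0" using assms by simp
  have "((1 - u) * x + u * y)\<^sup>2 < (1 - u) * x\<^sup>2 + u * y\<^sup>2"
    using u assms(1) by (simp add: square)
  hence "(((1 - u) * x + u * y)\<^sup>2)\<^sup>2 < ((1 - u) * x\<^sup>2 + u * y\<^sup>2)\<^sup>2"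
    by (rule power_strict_mono) auto
  also have "\<dots> \<le> (1 - u) * (x\<^sup>2)\<^sup>2 + u * (y\<^sup>2)\<^sup>2"
    using u by (simp add: square)
  finally show ?thesis by simp
qed

text \<open>Distinct y and z differ in some coordinate, where strict convexity of the fourth power
  pushes the sum for x strictly below 1.\<close>

lemma extreme_point_of_quartic_body:
  fixes x :: "real ^ 'n"
  assumes "(\<Sum>i\<in>UNIV. (x $ i) ^ 4) = 1"
  shows "x extreme_point_of quartic_body"
  unfolding extreme_point_of_def
proof (intro conjI ballI notI)
  show "x \<in> quartic_body" using assms by (simp add: quartic_body_def)
next
  fix y z :: "real ^ 'n"
  assume yz: "y \<in> quartic_body" "z \<in> quartic_body" and "x \<in> open_segment y z"
  then obtain u where "y \<noteq> z" and u: "0 < u" "u < 1" "x = (1 - u) *\<^sub>R y + u *\<^sub>R z"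
    by (auto simp: in_segment)
  from \<open>y \<noteq> z\<close> obtain j where j: "y $ j \<noteq> z $ j" by (auto simp: vec_eq_iff)
  have less: "(x $ i) ^ 4 < (1 - u) * (y $ i) ^ 4 + u * (z $ i) ^ 4" if "y $ i \<noteq> z $ i" for i
    using fourth_power_strictly_convex[OF that] u by simp
  have "(x $ i) ^ 4 \<le> (1 - u) * (y $ i) ^ 4 + u * (z $ i) ^ 4" for i
  proof (cases "y $ i = z $ i")
    case True
    thus ?thesis by (simp add: u flip: distrib_right)
  qed (use less in force)
  hence "(\<Sum>i\<in>UNIV. (x $ i) ^ 4) < (\<Sum>i\<in>UNIV. (1 - u) * (y $ i) ^ 4 + u * (z $ i) ^ 4)"
    using less[OF j] by (intro sum_strict_mono_ex1) auto
  also have "\<dots> = (1 - u) * (\<Sum>i\<in>UNIV. (y $ i) ^ 4) + u * (\<Sum>i\<in>UNIV. (z $ i) ^ 4)"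
    by (simp add: sum.distrib sum_distrib_left)
  also have "\<dots> \<le> (1 - u) * 1 + u * 1"
    using yz u by (intro add_mono mult_left_mono) (auto simp: quartic_body_def)
  finally show False using assms by simp
qed

section \<open>The failing configuration in a coordinate plane\<close>

definition plane_point :: "'n \<Rightarrow> 'n \<Rightarrow> real \<Rightarrow> real \<Rightarrow> real ^ 'n" where
  "plane_point i j s t = s *\<^sub>R axis i 1 + t *\<^sub>R axis j 1"

lemma plane_point_nth:
  assumes "i \<noteq> j"
  shows "plane_point i j s t $ i = s" "plane_point i j s t $ j = t"
  using assms by (auto simp: plane_point_def axis_def)

lemma sum_plane_point_power4:
  assumes "i \<noteq> j"
  shows "(\<Sum>k\<in>UNIV. (plane_point i j s t $ k) ^ 4) = s ^ 4 + t ^ 4"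
proof -
  have "(\<Sum>k\<in>UNIV. (plane_point i j s t $ k) ^ 4) = (\<Sum>k\<in>{i, j}. (plane_point i j s t $ k) ^ 4)"
    by (rule sum.mono_neutral_right) (auto simp: plane_point_def axis_def)
  thus ?thesis using assms by (simp add: plane_point_nth)
qed

lemma plane_point_in_segmentI:
  assumes "0 \<le> u" "u \<le> 1" "s = (1 - u) * s1 + u * s2" "t = (1 - u) * t1 + u * t2"
  shows "plane_point i j s t \<in> closed_segment (plane_point i j s1 t1) (plane_point i j s2 t2)"
  unfolding in_segment using assms(1,2)
  by (intro exI[of _ u]) (simp add: plane_point_def assms(3,4) algebra_simps)

lemma quartic_body_homology_counterexample:
  assumes "CARD('n::finite) \<ge> 2"
  shows "models (segment_structure (quartic_body :: (real ^ 'n) set)) homology_counterexample"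
proof -
  obtain i j :: 'n where ij: "i \<noteq> j"
    using assms card_le_Suc0_iff_eq[of "UNIV :: 'n set"] by auto
  define P where "P = plane_point i j"
  define c :: real where "c = sqrt (sqrt (1 / 2))"
  have c0: "c > 0" by (simp add: c_def)
  have c2: "c\<^sup>2 = sqrt (1 / 2)" by (simp add: c_def)
  have c4: "c ^ 4 = 1 / 2"
    using arg_cong[OF c2, of "\<lambda>t. t\<^sup>2"] by simp
  \<comment> \<open>This makes the parameter (2 c - 1) / (1 + 2 c) of m on the segment from b to a'
    nonnegative.\<close>
  have half: "1 / 2 \<le> c"
  proof (rule ccontr)
    assume "\<not> 1 / 2 \<le> c"
    hence "c ^ 4 < (1 / 2) ^ 4" using c0 by (intro power_strict_mono) auto
    thus False by (simp add: c4 power_divide)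
  qed
  \<comment> \<open>The chord b b' crosses the first axis at p, and so does its mirror image d d'.
    The point m below is the intersection of the line s + t = 1 through a and d' with the line
    through b and a'.\<close>
  define p where "p = P (c / (1 + c)) 0"
  define m where "m = P (1 / (1 + 2 * c)) (2 * c / (1 + 2 * c))"
  have ext: "P s t extreme_point_of quartic_body" if "s ^ 4 + t ^ 4 = 1" for s t
    using that ij unfolding P_def
    by (intro extreme_point_of_quartic_body) (simp add: sum_plane_point_power4)
  have mem: "P s t \<in> quartic_body \<longleftrightarrow> s ^ 4 + t ^ 4 \<le> 1" for s t
    using ij by (simp add: P_def quartic_body_def sum_plane_point_power4)
  have seg: "P s t \<in> closed_segment (P s1 t1) (P s2 t2)"
    if "0 \<le> u" "u \<le> 1" "s = (1 - u) * s1 + u * s2" "t = (1 - u) * t1 + u * t2"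
    for u s t s1 t1 s2 t2
    using plane_point_in_segmentI[OF that] by (simp add: P_def)
  have nth: "P s t $ i = s" "P s t $ j = t" for s t
    using ij by (simp_all add: P_def plane_point_nth)
  have p1: "p \<in> closed_segment (P 1 0) (P (-1) 0)"
  proof -
    \<comment> \<open>This is \<open>(1 + c)\<^sup>2\<close> multiplied out.\<close>
    have "1 + (c * c + c * 2) \<noteq> 0"
      using zero_less_mult_iff[of c c] c0 by linarith
    thus ?thesis
      unfolding p_def using c0
      by (intro seg[of "1 / (2 + 2 * c)"]) (auto simp: divide_simps algebra_simps)
  qed
  have ne1: "p \<noteq> P 1 0"
  proof
    assume "p = P 1 0"
    from arg_cong[OF this, of "\<lambda>x. x $ i"] show False
      using c0 by (simp add: p_def nth field_simps)
  qed
  have ne2: "p \<noteq> P (-1) 0"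
  proof
    assume "p = P (-1) 0"
    from arg_cong[OF this, of "\<lambda>x. x $ i"] show False
      using c0 by (simp add: p_def nth field_simps)
  qed
  have p2: "p \<in> closed_segment (P c c) (P 0 (-1))" "p \<in> closed_segment (P c (-c)) (P 0 1)"
    unfolding p_def using c0 by (intro seg[of "c / (1 + c)"]; simp add: field_simps)+
  have m1: "m \<in> closed_segment (P 1 0) (P 0 1)"
    unfolding m_def using c0 by (intro seg[of "2 * c / (1 + 2 * c)"]) (auto simp: field_simps)
  have m2: "m \<in> closed_segment (P c c) (P (-1) 0)"
    unfolding m_def using c0 half
    by (intro seg[of "(2 * c - 1) / (1 + 2 * c)"]) (auto simp: field_simps)
  have "p \<in> quartic_body"
  proof -
    have "(c / (1 + c)) ^ 4 \<le> 1 ^ 4" using c0 by (intro power_mono) auto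
    thus ?thesis by (simp add: p_def mem)
  qed
  moreover have "m \<in> quartic_body"
  proof -
    \<comment> \<open>The fourth powers of the coordinates of m sum to the quotient of these two
      sides; the other binomial terms on the right are positive.\<close>
    have "(1 + 16 * c ^ 4) \<le> (1 + 2 * c) ^ 4"
      using c0 by (simp add: power4_eq_xxxx algebra_simps)
    thus ?thesis using c0 by (simp add: m_def mem power_divide field_simps)
  qed
  moreover have "p \<notin> closed_segment m m'"
    if m': "m' \<in> closed_segment (P (-1) 0) (P c (-c))" "m' \<in> closed_segment (P 0 (-1)) (P 1 0)" for m'
  proof
    assume pm: "p \<in> closed_segment m m'"
    obtain u where u: "m' = (1 - u) *\<^sub>R P (-1) 0 + u *\<^sub>R P c (-c)"
      using m'(1) by (auto simp: in_segment)
    obtain v where v: "m' = (1 - v) *\<^sub>R P 0 (-1) + v *\<^sub>R P 1 0"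
      using m'(2) by (auto simp: in_segment)
    have ui: "m' $ i = u - 1 + u * c" "m' $ j = - (u * c)"
      by (simp_all add: u nth)
    have vi: "m' $ i = v" "m' $ j = v - 1"
      by (simp_all add: v nth)
    \<comment> \<open>Equating coordinates determines u and v, so m' is the mirror image of m in the
      first axis. Only the equality of first coordinates is needed: all points between m and m'
      share it.\<close>
    have "(1 + 2 * c) * u = 2" using ui vi by (simp add: algebra_simps)
    moreover have "v = 1 - u * c" using vi ui by simp
    hence "(1 + 2 * c) * v = (1 + 2 * c) * (1 - u * c)" by simp
    hence "(1 + 2 * c) * v = (1 + 2 * c) - c * ((1 + 2 * c) * u)"
      by (simp only: algebra_simps mult_1_left mult_1_right)
    ultimately have "(1 + 2 * c) * v = 1" by simp
    hence "m' $ i = 1 / (1 + 2 * c)" using c0 by (simp add: vi field_simps)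
    hence eq: "m' $ i = m $ i" by (simp add: m_def nth)
    obtain w where "p = (1 - w) *\<^sub>R m + w *\<^sub>R m'"
      using pm by (auto simp: in_segment)
    hence "p $ i = (1 - w) * m $ i + w * m' $ i" by simp
    also have "\<dots> = m $ i" unfolding eq by (simp add: left_diff_distrib)
    finally have "p $ i = m $ i" .
    hence "c / (1 + c) = 1 / (1 + 2 * c)" by (simp add: p_def m_def nth)
    \<comment> \<open>Cross-multiplying leaves c + 2 c^2 = 1 + c. Squaring
      \<open>c\<^sup>2 = 1 / 2\<close> gives c^4 = 1/4, against c^4 = 1/2.\<close>
    hence "c\<^sup>2 = 1 / 2" using c0 by (simp add: field_simps power2_eq_square)
    from arg_cong[OF this, of "\<lambda>t. t\<^sup>2"] show False using c4 by (simp add: power_divide)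
  qed
  moreover have ext': "P 1 0 extreme_point_of quartic_body" "P (-1) 0 extreme_point_of quartic_body"
    "P c c extreme_point_of quartic_body" "P 0 (-1) extreme_point_of quartic_body"
    "P c (-c) extreme_point_of quartic_body" "P 0 1 extreme_point_of quartic_body"
    by (auto intro!: ext simp: c4)
  moreover have "P 1 0 \<in> quartic_body" "P (-1) 0 \<in> quartic_body" "P c c \<in> quartic_body"
    "P 0 (-1) \<in> quartic_body" "P c (-c) \<in> quartic_body" "P 0 1 \<in> quartic_body"
    using ext' by (simp_all add: extreme_point_of_def)
  ultimately show ?thesis
    unfolding models_homology_counterexample using p1 ne1 ne2 p2 m1 m2 by blast
qed

theorem theorem9p24:
  assumes "CARD('n::finite) \<ge> 2"
  shows "\<not> elementarily_equivalent
           (segment_structure (cball 0 1 :: (real ^ 'n) set))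
           (segment_structure (quartic_body :: (real ^ 'n) set))"
  using cball_no_homology_counterexample[where 'a = "real ^ 'n"]
    quartic_body_homology_counterexample[OF assms] sentence_homology_counterexample
  unfolding elementarily_equivalent_def by blast

end
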